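(* Let $N\geq 1$, $s\in(0,1)$, $p\in[1,\infty)$, and let $(\rho_\varepsilon)_{\varepsilon>0}\subset L^1(\mathbb{R}^N)$ be a family of mollifiers of the form $\rho_\varepsilon(h)=\varepsilon^{-N}\rho(h/\varepsilon)$ for some $\rho\in L^1(\mathbb{R}^N)$. Then for $f\in L^p(\mathbb{R}^N)$ the following are equivalent: (i) $f\in B_{p,\infty}^s(\mathbb{R}^N)$; (ii) $\displaystyle\limsup_{\varepsilon\downarrow 0}\int_{\mathbb{R}^N}\int_{\mathbb{R}^N}\rho_\varepsilon(h)\frac{|f(x+h)-f(x)|^p}{|h|^{sp}}\,\mathrm{d}x\,\mathrm{d}h<\infty$. Moreover, there are constants $0<c\le C$ independent of $f$ such that for all $f\in L^p(\mathbb{R}^N)$ \[ c\,\|f\|_{B_{p,\infty}^s(\mathbb{R}^N)}^p\le \|f\|_{L^p(\mathbb{R}^N)}^p+\sup_{\varepsilon\in(0,1)}\int_{\mathbb{R}^N}\int_{\mathbb{R}^N}\rho_\varepsilon(h)\frac{|f(x+h)-f(x)|^p}{|h|^{sp}}\,\mathrm{d}x\,\mathrm{d}h\le C\,\|f\|_{B_{p,\infty}^s(\mathbb{R}^N)}^p .\]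
   Context: A family $(\rho_\varepsilon)_{\varepsilon>0}\subset L^1(\mathbb{R}^N)$ is a family of mollifiers if $\rho_\varepsilon\ge0$, $\int_{\mathbb{R}^N}\rho_\varepsilon=1$ for every $\varepsilon>0$, and $\lim_{\varepsilon\downarrow0}\int_{|z|\ge\delta}\rho_\varepsilon(z)\,\mathrm{d}z=0$ for every $\delta>0$. For $s\in(0,1)$ and $p\in[1,\infty]$, $B^s_{p,\infty}(\mathbb{R}^N)$ is the set of $f\in L^p(\mathbb{R}^N)$ with $[f]_{B^s_{p,\infty}}:=\sup_{h\neq0}|h|^{-s}\|f(\cdot+h)-f\|_{L^p(\mathbb{R}^N)}<\infty$, normed by $\|f\|_{B^s_{p,\infty}}=\|f\|_{L^p}+[f]_{B^s_{p,\infty}}$. *)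

theory Defs
  imports "HOL-Analysis.Analysis"
begin

text \<open>Real power of an extended nonnegative real (used for p > 0); infinity stays infinity.\<close>
definition epow :: "ennreal \<Rightarrow> real \<Rightarrow> ennreal" where
  "epow x q = (if x = top then top else ennreal (enn2real x powr q))"

text \<open>Membership in L^p(R^N), 1 <= p < infinity, w.r.t. Lebesgue measure.\<close>
definition in_Lp :: "real \<Rightarrow> ('a::euclidean_space \<Rightarrow> real) \<Rightarrow> bool" where
  "in_Lp p f \<longleftrightarrow> f \<in> borel_measurable lebesgue \<and> integrable lebesgue (\<lambda>x. \<bar>f x\<bar> powr p)"

text \<open>L^p norm (possibly infinite).\<close>
definition Lp_norm :: "real \<Rightarrow> ('a::euclidean_space \<Rightarrow> real) \<Rightarrow> ennreal" where
  "Lp_norm p f = epow (\<integral>\<^sup>+ x. ennreal (\<bar>f x\<bar> powr p) \<partial>lebesgue) (1 / p)"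

text \<open>Besov seminorm [f]_{B^s_{p,infinity}} = sup_{h <> 0} |h|^{-s} ||f(.+h) - f||_{L^p}.\<close>
definition besov_seminorm :: "real \<Rightarrow> real \<Rightarrow> ('a::euclidean_space \<Rightarrow> real) \<Rightarrow> ennreal" where
  "besov_seminorm s p f =
     (SUP h\<in>UNIV - {0}. Lp_norm p (\<lambda>x. f (x + h) - f x) / ennreal (norm h powr s))"

definition besov_norm :: "real \<Rightarrow> real \<Rightarrow> ('a::euclidean_space \<Rightarrow> real) \<Rightarrow> ennreal" where
  "besov_norm s p f = Lp_norm p f + besov_seminorm s p f"

definition in_Besov :: "real \<Rightarrow> real \<Rightarrow> ('a::euclidean_space \<Rightarrow> real) \<Rightarrow> bool" where
  "in_Besov s p f \<longleftrightarrow> in_Lp p f \<and> besov_seminorm s p f < top"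

text \<open>Family of mollifiers (indexed by eps > 0).\<close>
definition mollifier_family :: "(real \<Rightarrow> 'a::euclidean_space \<Rightarrow> real) \<Rightarrow> bool" where
  "mollifier_family \<rho> \<longleftrightarrow>
     (\<forall>\<epsilon>>0. integrable lebesgue (\<rho> \<epsilon>) \<and> (AE h in lebesgue. 0 \<le> \<rho> \<epsilon> h)
            \<and> integral\<^sup>L lebesgue (\<rho> \<epsilon>) = 1) \<and>
     (\<forall>\<delta>>0. ((\<lambda>\<epsilon>. \<integral>h. indicator {h. \<delta> \<le> norm h} h * \<rho> \<epsilon> h \<partial>lebesgue) \<longlongrightarrow> 0) (at_right 0))"

text \<open>Rescaled kernel rho_eps(h) = eps^{-N} rho(h/eps).\<close>
definition rescale :: "('a::euclidean_space \<Rightarrow> real) \<Rightarrow> real \<Rightarrow> 'a \<Rightarrow> real" where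
  "rescale \<rho> \<epsilon> h = inverse (\<epsilon> ^ DIM('a)) * \<rho> (scaleR (inverse \<epsilon>) h)"

text \<open>The double integral  int int rho_eps(h) |f(x+h)-f(x)|^p / |h|^{sp} dx dh  (in [0,infinity]).\<close>
definition moll_energy ::
  "(real \<Rightarrow> 'a::euclidean_space \<Rightarrow> real) \<Rightarrow> real \<Rightarrow> real \<Rightarrow> ('a \<Rightarrow> real) \<Rightarrow> real \<Rightarrow> ennreal" where
  "moll_energy \<rho> s p f \<epsilon> =
     (\<integral>\<^sup>+ h. \<integral>\<^sup>+ x. ennreal (\<rho> \<epsilon> h * \<bar>f (x + h) - f x\<bar> powr p / norm h powr (s * p)) \<partial>lebesgue \<partial>lebesgue)"

end

theory Submission
  imports Defs
begin

text \<open>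
  Write \<open>\<omega>(h) = \<integral> |f(x + h) - f(x)|^p dx\<close>, so that \<open>[f]^p\<close> is the supremum of \<open>\<omega>(h) / |h|^(sp)\<close> over \<open>h \<noteq> 0\<close>.
  If \<open>\<omega>(h) \<le> B |h|^(sp)\<close>, every mollified energy is at most \<open>B\<close> because \<open>\<rho>\<^sub>\<epsilon>\<close> has mass one;
  this gives the upper bound. Conversely, \<open>\<rho> \<ge> \<delta>\<close> on a compact set \<open>K\<close> whose translates by
  vectors shorter than \<open>d\<close> meet \<open>K\<close> in measure at least \<open>m\<close> (a Steinhaus-type argument).
  Averaging the quasi-triangle inequality \<open>\<omega>(h) \<le> 2^p (\<omega>(y) + \<omega>(y + h))\<close> over
  \<open>y \<in> \<epsilon>K \<inter> (\<epsilon>K - h)\<close> with \<open>\<epsilon> = 2|h|/d\<close> bounds \<open>\<omega>(h) / |h|^(sp)\<close> by a multiple of the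
  energy at scale \<open>\<epsilon>\<close>, while for \<open>|h|\<close> bounded below \<open>\<omega>(h) \<le> 2^(p+1) \<parallel>f\<parallel>\<^sub>p^p\<close> suffices.
\<close>

section \<open>Elementary inequalities\<close>

lemma abs_add_powr_le:
  fixes a b p :: real
  assumes "0 \<le> p"
  shows "\<bar>a + b\<bar> powr p \<le> 2 powr p * (\<bar>a\<bar> powr p + \<bar>b\<bar> powr p)"
proof -
  have "\<bar>a + b\<bar> powr p \<le> (2 * max \<bar>a\<bar> \<bar>b\<bar>) powr p"
    by (intro powr_mono2) (use assms in auto)
  also have "\<dots> = 2 powr p * max \<bar>a\<bar> \<bar>b\<bar> powr p"
    by (simp add: powr_mult)
  also have "max \<bar>a\<bar> \<bar>b\<bar> powr p \<le> \<bar>a\<bar> powr p + \<bar>b\<bar> powr p"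
    by (cases "\<bar>a\<bar> \<le> \<bar>b\<bar>") (auto simp: max_def)
  finally show ?thesis by (simp add: mult_left_mono)
qed

text \<open>Each summand's share \<open>t \<in> [0, 1]\<close> of \<open>a + b\<close> satisfies \<open>t powr p \<le> t\<close>.\<close>
lemma add_powr_le_powr_add:
  fixes a b p :: real
  assumes "0 \<le> a" "0 \<le> b" "1 \<le> p"
  shows "a powr p + b powr p \<le> (a + b) powr p"
proof (cases "a + b = 0")
  case True
  then have "a = 0" "b = 0" using assms by auto
  then show ?thesis by simp
next
  case False
  then have ab: "0 < a + b" using assms by simp
  have share: "x powr p \<le> (a + b) powr p * (x / (a + b))" if "0 \<le> x" "x \<le> a + b" for x
  proof -
    have "(x / (a + b)) powr p \<le> (x / (a + b)) powr 1"
    proof (cases "x = 0")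
      case False
      then show ?thesis using that ab assms by (intro powr_mono') auto
    qed simp
    then have "(a + b) powr p * (x / (a + b)) powr p \<le> (a + b) powr p * (x / (a + b))"
      using that ab by (intro mult_left_mono) auto
    then show ?thesis using that ab by (simp add: powr_divide)
  qed
  have "(a + b) powr p * (a / (a + b)) + (a + b) powr p * (b / (a + b)) = (a + b) powr p"
    using ab by (simp add: add_divide_distrib[symmetric] distrib_left[symmetric])
  with share[of a] share[of b] assms show ?thesis by linarith
qed

lemma powr_add_le_of_powr_bound:
  fixes L \<beta> S C\<^sub>1 C\<^sub>2 p :: real
  assumes "0 \<le> L" "0 \<le> \<beta>" "0 \<le> S" "0 \<le> C\<^sub>1" "0 \<le> C\<^sub>2" "0 \<le> p"
    and \<beta>: "\<beta> powr p \<le> C\<^sub>1 * S + C\<^sub>2 * L powr p"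
  shows "(L + \<beta>) powr p \<le> 2 powr p * (1 + C\<^sub>1 + C\<^sub>2) * (L powr p + S)"
proof -
  have "(L + \<beta>) powr p \<le> 2 powr p * (L powr p + \<beta> powr p)"
    using abs_add_powr_le[of p L \<beta>] assms by simp
  also have "L powr p + \<beta> powr p \<le> L powr p + (C\<^sub>1 * S + C\<^sub>2 * L powr p) + (S + C\<^sub>1 * L powr p + C\<^sub>2 * S)"
  proof -
    have "0 \<le> S + C\<^sub>1 * L powr p + C\<^sub>2 * S"
      using assms by simp
    then show ?thesis
      using \<beta> by linarith
  qed
  also have "\<dots> = (1 + C\<^sub>1 + C\<^sub>2) * (L powr p + S)"
    by (simp add: algebra_simps)
  finally show ?thesis
    by (simp add: mult_left_mono mult.assoc)
qed

section \<open>Translations\<close>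

lemma nn_integral_lborel_add:
  fixes u :: "'a::euclidean_space \<Rightarrow> ennreal"
  assumes [measurable]: "u \<in> borel_measurable borel"
  shows "(\<integral>\<^sup>+x. u (x + h) \<partial>lborel) = (\<integral>\<^sup>+x. u x \<partial>lborel)"
proof -
  have "(\<integral>\<^sup>+x. u x \<partial>lborel) = (\<integral>\<^sup>+x. u x \<partial>distr lborel borel ((+) h))"
    by (simp add: lborel_distr_plus)
  also have "\<dots> = (\<integral>\<^sup>+x. u (h + x) \<partial>lborel)"
    by (subst nn_integral_distr) auto
  finally show ?thesis by (simp add: add.commute)
qed

lemma AE_lborel_add:
  fixes h :: "'a::euclidean_space"
  assumes "AE x in lborel. P x"
  shows "AE x in lborel. P (x + h)"
proof -
  obtain N where "{x\<in>space lborel. \<not> P x} \<subseteq> N" "emeasure lborel N = 0" "N \<in> sets lborel"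
    using AE_E[OF assms] by blast
  then have N: "{x\<in>space lborel. \<not> P x} \<subseteq> N" "N \<in> null_sets lborel"
    by auto
  have "{x. x - (- h) \<in> N} \<in> null_sets lborel"
    by (rule null_sets_translation[OF N(2)])
  moreover have "{x\<in>space lborel. \<not> P (x + h)} \<subseteq> {x. x - (- h) \<in> N}"
    using N(1) by auto
  ultimately show ?thesis by (rule AE_I')
qed

lemma nn_integral_lborel_cong_AE_translate:
  fixes f g :: "'a::euclidean_space \<Rightarrow> 'b"
  assumes ae: "AE x in lborel. f x = g x"
  shows "(\<integral>\<^sup>+ x. F (f (x + h)) (f x) \<partial>lborel) = (\<integral>\<^sup>+ x. F (g (x + h)) (g x) \<partial>lborel)"
proof (rule nn_integral_cong_AE)
  show "AE x in lborel. F (f (x + h)) (f x) = F (g (x + h)) (g x)"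
    using ae AE_lborel_add[OF ae, of h] by eventually_elim simp
qed

section \<open>\<open>L\<^sup>p\<close> increments\<close>

definition Lp_integral :: "real \<Rightarrow> ('a::euclidean_space \<Rightarrow> real) \<Rightarrow> ennreal" where
  "Lp_integral p f = (\<integral>\<^sup>+ x. ennreal (\<bar>f x\<bar> powr p) \<partial>lborel)"

definition increment_integral :: "real \<Rightarrow> ('a::euclidean_space \<Rightarrow> real) \<Rightarrow> 'a \<Rightarrow> ennreal" where
  "increment_integral p f h = (\<integral>\<^sup>+ x. ennreal (\<bar>f (x + h) - f x\<bar> powr p) \<partial>lborel)"

lemma increment_integral_measurable [measurable]:
  assumes [measurable]: "f \<in> borel_measurable borel"
  shows "increment_integral p f \<in> borel_measurable borel"
  unfolding increment_integral_def[abs_def] by measurable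

lemma increment_integral_zero [simp]: "increment_integral p f 0 = 0"
  by (simp add: increment_integral_def)

lemma nn_integral_cmult_add:
  assumes "f \<in> borel_measurable M" "g \<in> borel_measurable M"
  shows "(\<integral>\<^sup>+ x. c * (f x + g x) \<partial>M) = c * ((\<integral>\<^sup>+ x. f x \<partial>M) + (\<integral>\<^sup>+ x. g x \<partial>M))"
  using assms by (simp add: nn_integral_cmult nn_integral_add)

lemma ennreal_abs_add_powr_le:
  assumes "0 \<le> p"
  shows "ennreal (\<bar>a + b\<bar> powr p) \<le> ennreal (2 powr p) * (ennreal (\<bar>a\<bar> powr p) + ennreal (\<bar>b\<bar> powr p))"
proof -
  have "ennreal (\<bar>a + b\<bar> powr p) \<le> ennreal (2 powr p * (\<bar>a\<bar> powr p + \<bar>b\<bar> powr p))"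
    by (rule ennreal_leI[OF abs_add_powr_le[OF assms]])
  then show ?thesis by (simp add: ennreal_mult ennreal_plus)
qed

lemma increment_integral_le_Lp_integral:
  assumes [measurable]: "f \<in> borel_measurable borel" and p: "0 \<le> p"
  shows "increment_integral p f h \<le> ennreal (2 powr p) * (2 * Lp_integral p f)"
proof -
  have "increment_integral p f h
      \<le> (\<integral>\<^sup>+ x. ennreal (2 powr p) * (ennreal (\<bar>f (x + h)\<bar> powr p) + ennreal (\<bar>f x\<bar> powr p)) \<partial>lborel)"
    unfolding increment_integral_def
  proof (intro nn_integral_mono)
    fix x
    show "ennreal (\<bar>f (x + h) - f x\<bar> powr p)
        \<le> ennreal (2 powr p) * (ennreal (\<bar>f (x + h)\<bar> powr p) + ennreal (\<bar>f x\<bar> powr p))"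
      using ennreal_abs_add_powr_le[OF p, of "f (x + h)" "- f x"] by simp
  qed
  also have "\<dots> = ennreal (2 powr p) * ((\<integral>\<^sup>+ x. ennreal (\<bar>f (x + h)\<bar> powr p) \<partial>lborel) + Lp_integral p f)"
    unfolding Lp_integral_def by (intro nn_integral_cmult_add) measurable
  also have "(\<integral>\<^sup>+ x. ennreal (\<bar>f (x + h)\<bar> powr p) \<partial>lborel) = Lp_integral p f"
    unfolding Lp_integral_def by (rule nn_integral_lborel_add) simp
  finally show ?thesis by (simp add: mult_2)
qed

lemma increment_integral_triangle:
  assumes [measurable]: "f \<in> borel_measurable borel" and p: "0 \<le> p"
  shows "increment_integral p f h \<le> ennreal (2 powr p) * (increment_integral p f u + increment_integral p f (h + u))"
proof -
  have "increment_integral p f h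
      \<le> (\<integral>\<^sup>+ x. ennreal (2 powr p) * (ennreal (\<bar>f (x + h) - f (x + h + u)\<bar> powr p)
                                      + ennreal (\<bar>f (x + (h + u)) - f x\<bar> powr p)) \<partial>lborel)"
    unfolding increment_integral_def
  proof (intro nn_integral_mono)
    fix x
    show "ennreal (\<bar>f (x + h) - f x\<bar> powr p)
        \<le> ennreal (2 powr p) * (ennreal (\<bar>f (x + h) - f (x + h + u)\<bar> powr p)
                                  + ennreal (\<bar>f (x + (h + u)) - f x\<bar> powr p))"
      using ennreal_abs_add_powr_le[OF p, of "f (x + h) - f (x + h + u)" "f (x + (h + u)) - f x"]
      by (simp add: add.assoc)
  qed
  also have "\<dots> = ennreal (2 powr p) * ((\<integral>\<^sup>+ x. ennreal (\<bar>f (x + h) - f (x + h + u)\<bar> powr p) \<partial>lborel)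
                                       + increment_integral p f (h + u))"
    unfolding increment_integral_def by (intro nn_integral_cmult_add) measurable
  also have "(\<integral>\<^sup>+ x. ennreal (\<bar>f (x + h) - f (x + h + u)\<bar> powr p) \<partial>lborel) = increment_integral p f u"
  proof -
    have "(\<integral>\<^sup>+ x. ennreal (\<bar>f (x + h) - f (x + h + u)\<bar> powr p) \<partial>lborel)
        = (\<integral>\<^sup>+ x. ennreal (\<bar>f x - f (x + u)\<bar> powr p) \<partial>lborel)"
      by (rule nn_integral_lborel_add[where u="\<lambda>x. ennreal (\<bar>f x - f (x + u)\<bar> powr p)"]) simp
    then show ?thesis unfolding increment_integral_def by (simp add: abs_minus_commute)
  qed
  finally show ?thesis .
qed

lemma increment_integral_less_top:
  assumes "f \<in> borel_measurable borel" "0 \<le> p" "Lp_integral p f < \<infinity>"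
  shows "increment_integral p f h < \<infinity>"
proof (rule le_less_trans)
  show "increment_integral p f h \<le> ennreal (2 powr p) * (2 * Lp_integral p f)"
    by (rule increment_integral_le_Lp_integral[OF assms(1,2)])
  show "ennreal (2 powr p) * (2 * Lp_integral p f) < \<infinity>"
    using assms(3) by (simp add: ennreal_mult_less_top)
qed

lemma enn2real_increment_integral_le:
  assumes "f \<in> borel_measurable borel" "0 \<le> p" "Lp_integral p f < \<infinity>"
  shows "enn2real (increment_integral p f h) \<le> 2 powr p * 2 * enn2real (Lp_integral p f)"
proof -
  have "enn2real (increment_integral p f h) \<le> enn2real (ennreal (2 powr p) * (2 * Lp_integral p f))"
    using increment_integral_le_Lp_integral[OF assms(1,2)] assms(3)
    by (intro enn2real_mono) (simp_all add: ennreal_mult_less_top)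
  then show ?thesis by (simp add: enn2real_mult)
qed

lemma increment_integral_overlap_average:
  fixes A :: "'a::euclidean_space set"
  assumes [measurable]: "f \<in> borel_measurable borel" "A \<in> sets borel" and p: "0 \<le> p"
  shows "increment_integral p f h * emeasure lebesgue {y \<in> A. y + h \<in> A}
    \<le> ennreal (2 * 2 powr p) * (\<integral>\<^sup>+ y. indicator A y * increment_integral p f y \<partial>lborel)"
proof -
  define J where "J = (\<integral>\<^sup>+ y. indicator A y * increment_integral p f y \<partial>lborel)"
  have "{y \<in> space borel. y \<in> A \<and> y + h \<in> A} \<in> sets borel"
    by measurable
  then have [measurable]: "{y \<in> A. y + h \<in> A} \<in> sets borel"
    by simp
  have "increment_integral p f h * emeasure lebesgue {y \<in> A. y + h \<in> A}
      = (\<integral>\<^sup>+ y. increment_integral p f h * indicator {y \<in> A. y + h \<in> A} y \<partial>lebesgue)"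
    by (simp add: nn_integral_cmult_indicator)
  also have "\<dots> = (\<integral>\<^sup>+ y. increment_integral p f h * indicator {y \<in> A. y + h \<in> A} y \<partial>lborel)"
    by (simp add: nn_integral_completion)
  also have "\<dots> \<le> (\<integral>\<^sup>+ y. ennreal (2 powr p) * (indicator A y * increment_integral p f y
                   + indicator A (y + h) * increment_integral p f (y + h)) \<partial>lborel)"
    using increment_integral_triangle[OF assms(1) p, of h]
    by (intro nn_integral_mono) (auto simp: indicator_def add.commute)
  also have "\<dots> = ennreal (2 powr p) * (J + (\<integral>\<^sup>+ y. indicator A (y + h) * increment_integral p f (y + h) \<partial>lborel))"
    unfolding J_def by (intro nn_integral_cmult_add) measurable
  also have "(\<integral>\<^sup>+ y. indicator A (y + h) * increment_integral p f (y + h) \<partial>lborel) = J"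
    unfolding J_def by (rule nn_integral_lborel_add[where u="\<lambda>y. indicator A y * increment_integral p f y"]) measurable
  also have "ennreal (2 powr p) * (J + J) = ennreal (2 * 2 powr p) * J"
    by (simp add: mult_2[symmetric] ennreal_mult' mult.assoc mult.commute)
  finally show ?thesis
    unfolding J_def .
qed

lemma emeasure_scaled_overlap:
  fixes K :: "'a::euclidean_space set"
  assumes "0 < \<epsilon>"
  shows "emeasure lebesgue {y \<in> (*\<^sub>R) \<epsilon> ` K. y + h \<in> (*\<^sub>R) \<epsilon> ` K}
    = ennreal (\<epsilon> ^ DIM('a)) * emeasure lebesgue {v \<in> K. v + (1 / \<epsilon>) *\<^sub>R h \<in> K}"
proof -
  have "y + h = \<epsilon> *\<^sub>R (v + (1 / \<epsilon>) *\<^sub>R h)" if "y = \<epsilon> *\<^sub>R v" for y v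
    using that assms by (simp add: scaleR_add_right)
  then have "{y \<in> (*\<^sub>R) \<epsilon> ` K. y + h \<in> (*\<^sub>R) \<epsilon> ` K}
      = (\<lambda>v. \<epsilon> *\<^sub>R v + 0) ` {v \<in> K. v + (1 / \<epsilon>) *\<^sub>R h \<in> K}"
    using assms by (auto simp: image_iff)
  then show ?thesis
    using emeasure_lebesgue_affine[of \<epsilon> 0 "{v \<in> K. v + (1 / \<epsilon>) *\<^sub>R h \<in> K}"] assms
    by simp
qed

lemma in_Lp_borel_representative:
  fixes f :: "'a::euclidean_space \<Rightarrow> real"
  assumes "in_Lp p f"
  obtains g where "g \<in> borel_measurable borel" "Lp_integral p g < \<infinity>" "Lp_norm p f = Lp_norm p g"
    "besov_seminorm s p f = besov_seminorm s p g" "moll_energy \<kappa> s p f = moll_energy \<kappa> s p g"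
proof -
  have f: "f \<in> borel_measurable lebesgue" and int: "integrable lebesgue (\<lambda>x. \<bar>f x\<bar> powr p)"
    using assms by (auto simp: in_Lp_def)
  obtain g where g: "g \<in> borel_measurable lborel" and ae: "AE x in lborel. f x = g x"
    using completion_ex_borel_measurable_real[OF f] by auto
  have [measurable]: "g \<in> borel_measurable borel"
    using g by simp
  have Lp: "(\<integral>\<^sup>+ x. ennreal (\<bar>f x\<bar> powr p) \<partial>lborel) = Lp_integral p g"
    unfolding Lp_integral_def by (intro nn_integral_cong_AE) (use ae in \<open>eventually_elim, simp\<close>)
  have incr: "(\<integral>\<^sup>+ x. ennreal (\<bar>f (x + h) - f x\<bar> powr p) \<partial>lborel)
      = (\<integral>\<^sup>+ x. ennreal (\<bar>g (x + h) - g x\<bar> powr p) \<partial>lborel)" for h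
    by (rule nn_integral_lborel_cong_AE_translate[OF ae])
  show thesis
  proof (rule that)
    show "g \<in> borel_measurable borel"
      by measurable
    have "(\<integral>\<^sup>+ x. ennreal (\<bar>f x\<bar> powr p) \<partial>lebesgue) = ennreal (integral\<^sup>L lebesgue (\<lambda>x. \<bar>f x\<bar> powr p))"
      by (rule nn_integral_eq_integral[OF int]) simp
    then show "Lp_integral p g < \<infinity>"
      using Lp by (simp add: nn_integral_completion)
    show "Lp_norm p f = Lp_norm p g"
      using Lp by (simp add: Lp_norm_def Lp_integral_def nn_integral_completion)
    show "besov_seminorm s p f = besov_seminorm s p g"
      unfolding besov_seminorm_def Lp_norm_def nn_integral_completion incr ..
    show "moll_energy \<kappa> s p f = moll_energy \<kappa> s p g"
      unfolding moll_energy_def nn_integral_completion fun_eq_iff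
      by (rule allI, rule nn_integral_cong, rule nn_integral_lborel_cong_AE_translate[OF ae])
  qed
qed

section \<open>The Besov seminorm through increments\<close>

lemma epow_ennreal: "0 \<le> x \<Longrightarrow> epow (ennreal x) q = ennreal (x powr q)"
  by (simp add: epow_def)

lemma Lp_norm_eq_Lp_integral:
  assumes "Lp_integral p f < \<infinity>"
  shows "Lp_norm p f = ennreal (enn2real (Lp_integral p f) powr (1 / p))"
  using assms unfolding Lp_norm_def epow_def Lp_integral_def by (simp add: nn_integral_completion)

lemma epow_Lp_norm:
  assumes "Lp_integral p f < \<infinity>" "0 < p"
  shows "epow (Lp_norm p f) p = Lp_integral p f"
proof -
  define I where "I = enn2real (Lp_integral p f)"
  have "0 \<le> I" by (simp add: I_def)
  then have "epow (Lp_norm p f) p = ennreal I"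
    using assms by (simp add: Lp_norm_eq_Lp_integral I_def[symmetric] epow_ennreal powr_powr)
  then show ?thesis
    using assms(1) by (simp add: I_def)
qed

lemma Lp_norm_increment_eq:
  assumes "increment_integral p f h < \<infinity>"
  shows "Lp_norm p (\<lambda>x. f (x + h) - f x) = ennreal (enn2real (increment_integral p f h) powr (1 / p))"
  using assms unfolding Lp_norm_def epow_def increment_integral_def by (simp add: nn_integral_completion)

lemma besov_seminorm_eq_SUP:
  assumes "f \<in> borel_measurable borel" "1 \<le> p" "Lp_integral p f < \<infinity>"
  shows "besov_seminorm s p f
    = (SUP h\<in>UNIV - {0}. ennreal (enn2real (increment_integral p f h) powr (1 / p) / norm h powr s))"
  unfolding besov_seminorm_def
proof (intro SUP_cong refl)
  fix h :: 'a
  assume "h \<in> UNIV - {0}"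
  then have "0 < norm h powr s" by simp
  moreover have "increment_integral p f h < \<infinity>"
    using increment_integral_less_top[of f p] assms by simp
  ultimately show "Lp_norm p (\<lambda>x. f (x + h) - f x) / ennreal (norm h powr s)
      = ennreal (enn2real (increment_integral p f h) powr (1 / p) / norm h powr s)"
    by (simp add: Lp_norm_increment_eq divide_ennreal)
qed

lemma besov_seminorm_le_of_increment_bound:
  assumes f: "f \<in> borel_measurable borel" and p: "1 \<le> p" and fin: "Lp_integral p f < \<infinity>"
    and R: "0 \<le> R" "\<And>h. h \<noteq> 0 \<Longrightarrow> enn2real (increment_integral p f h) \<le> R * norm h powr (s * p)"
  shows "besov_seminorm s p f \<le> ennreal (R powr (1 / p))"
  unfolding besov_seminorm_eq_SUP[OF f p fin]
proof (intro SUP_least ennreal_leI)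
  fix h :: 'a
  assume "h \<in> UNIV - {0}"
  then have h: "h \<noteq> 0" by simp
  define G where "G = enn2real (increment_integral p f h)"
  have G: "0 \<le> G" "G / norm h powr (s * p) \<le> R"
    using R(2)[OF h] h by (simp_all add: G_def divide_le_eq)
  have "G powr (1 / p) / norm h powr s = (G / norm h powr (s * p)) powr (1 / p)"
    using G p h by (simp add: powr_divide powr_powr)
  also have "\<dots> \<le> R powr (1 / p)"
    using G p by (intro powr_mono2) auto
  finally show "enn2real (increment_integral p f h) powr (1 / p) / norm h powr s \<le> R powr (1 / p)"
    by (simp add: G_def)
qed

lemma increment_integral_le_besov_seminorm:
  assumes f: "f \<in> borel_measurable borel" and p: "1 \<le> p" and fin: "Lp_integral p f < \<infinity>"
    and bes: "besov_seminorm s p f < \<infinity>"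
  shows "enn2real (increment_integral p f h) \<le> enn2real (besov_seminorm s p f) powr p * norm h powr (s * p)"
proof (cases "h = 0")
  case False
  define \<beta> where "\<beta> = enn2real (besov_seminorm s p f)"
  define G where "G = enn2real (increment_integral p f h)"
  have \<beta>: "0 \<le> \<beta>" "besov_seminorm s p f = ennreal \<beta>"
    using bes by (simp_all add: \<beta>_def ennreal_enn2real_if)
  have G: "0 \<le> G" by (simp add: G_def)
  have "ennreal (G powr (1 / p) / norm h powr s) \<le> besov_seminorm s p f"
    unfolding besov_seminorm_eq_SUP[OF f p fin] G_def using False by (intro SUP_upper) auto
  then have "G powr (1 / p) / norm h powr s \<le> \<beta>"
    using \<beta> by (simp add: ennreal_le_iff)
  then have "G powr (1 / p) \<le> \<beta> * norm h powr s"
    using False by (simp add: divide_le_eq)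
  then have "(G powr (1 / p)) powr p \<le> (\<beta> * norm h powr s) powr p"
    using G p by (intro powr_mono2) auto
  moreover have "(G powr (1 / p)) powr p = G"
    using G p by (simp add: powr_powr)
  moreover have "(\<beta> * norm h powr s) powr p = \<beta> powr p * norm h powr (s * p)"
    using \<beta> by (simp add: powr_mult powr_powr)
  ultimately show ?thesis
    by (simp add: G_def \<beta>_def)
qed simp

lemma epow_besov_norm:
  assumes "1 \<le> p" "Lp_integral p f < \<infinity>" "besov_seminorm s p f < \<infinity>"
  shows "epow (besov_norm s p f) p
    = ennreal ((enn2real (Lp_integral p f) powr (1 / p) + enn2real (besov_seminorm s p f)) powr p)"
proof -
  define L where "L = enn2real (Lp_integral p f) powr (1 / p)"
  define \<beta> where "\<beta> = enn2real (besov_seminorm s p f)"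
  have "besov_norm s p f = ennreal L + ennreal \<beta>"
    using assms by (simp add: besov_norm_def Lp_norm_eq_Lp_integral L_def \<beta>_def)
  also have "\<dots> = ennreal (L + \<beta>)"
    by (rule ennreal_plus[symmetric]) (simp_all add: L_def \<beta>_def)
  finally show ?thesis
    by (simp add: epow_ennreal L_def \<beta>_def del: ennreal_plus)
qed

lemma epow_besov_norm_le_of_seminorm_bound:
  fixes f :: "'a::euclidean_space \<Rightarrow> real"
  assumes p: "1 \<le> p" and fin: "Lp_integral p f < \<infinity>" and C: "0 \<le> C\<^sub>1" "0 \<le> C\<^sub>2" and S: "0 \<le> S"
    and bound: "besov_seminorm s p f \<le> ennreal ((C\<^sub>1 * S + C\<^sub>2 * enn2real (Lp_integral p f)) powr (1 / p))"
  shows "ennreal (1 / (2 powr p * (1 + C\<^sub>1 + C\<^sub>2))) * epow (besov_norm s p f) p \<le> epow (Lp_norm p f) p + ennreal S"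
proof -
  define I where "I = enn2real (Lp_integral p f)"
  define L where "L = I powr (1 / p)"
  define \<beta> where "\<beta> = enn2real (besov_seminorm s p f)"
  define R where "R = C\<^sub>1 * S + C\<^sub>2 * I"
  have R: "0 \<le> R" and LI: "L powr p = I"
    using C S p by (simp_all add: R_def I_def L_def powr_powr)
  have bes: "besov_seminorm s p f < \<infinity>" and "\<beta> \<le> R powr (1 / p)"
    using bound le_less_trans by (fastforce simp: \<beta>_def R_def I_def enn2real_leI)+
  then have "\<beta> powr p \<le> (R powr (1 / p)) powr p"
    using p by (intro powr_mono2) (auto simp: \<beta>_def)
  then have "\<beta> powr p \<le> C\<^sub>1 * S + C\<^sub>2 * L powr p"
    using R p by (simp add: R_def LI powr_powr)
  then have "(L + \<beta>) powr p \<le> 2 powr p * (1 + C\<^sub>1 + C\<^sub>2) * (I + S)"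
    using powr_add_le_of_powr_bound[of L \<beta> S C\<^sub>1 C\<^sub>2 p] C S p unfolding LI by (simp add: L_def \<beta>_def)
  moreover have "0 < 2 powr p * (1 + C\<^sub>1 + C\<^sub>2)"
    using C by (simp add: add_pos_nonneg)
  ultimately have "(L + \<beta>) powr p / (2 powr p * (1 + C\<^sub>1 + C\<^sub>2)) \<le> I + S"
    by (simp add: pos_divide_le_eq mult.commute)
  then have "ennreal (1 / (2 powr p * (1 + C\<^sub>1 + C\<^sub>2)) * (L + \<beta>) powr p) \<le> ennreal (I + S)"
    by (intro ennreal_leI) simp
  then have "ennreal (1 / (2 powr p * (1 + C\<^sub>1 + C\<^sub>2))) * ennreal ((L + \<beta>) powr p) \<le> ennreal I + ennreal S"
    using C S by (simp add: ennreal_mult[symmetric] I_def)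
  then show ?thesis
    using epow_besov_norm[OF p fin bes] epow_Lp_norm[OF fin] fin p
    by (simp add: L_def I_def \<beta>_def ennreal_enn2real_if less_top[symmetric])
qed

section \<open>Upper bound for the mollified energies\<close>

definition probability_density :: "('a::euclidean_space \<Rightarrow> real) \<Rightarrow> bool" where
  "probability_density \<kappa> \<longleftrightarrow>
     integrable lebesgue \<kappa> \<and> (AE h in lebesgue. 0 \<le> \<kappa> h) \<and> integral\<^sup>L lebesgue \<kappa> = 1"

lemma nn_integral_probability_density:
  "probability_density \<kappa> \<Longrightarrow> (\<integral>\<^sup>+ h. ennreal (\<kappa> h) \<partial>lebesgue) = 1"
  unfolding probability_density_def by (simp add: nn_integral_eq_integral)

lemma mollifier_family_probability_density:
  "mollifier_family \<rho> \<Longrightarrow> 0 < \<epsilon> \<Longrightarrow> probability_density (\<rho> \<epsilon>)"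
  unfolding mollifier_family_def probability_density_def by blast

lemma moll_energy_le_of_increment_bound:
  fixes \<kappa> :: "real \<Rightarrow> 'a::euclidean_space \<Rightarrow> real"
  assumes f[measurable]: "f \<in> borel_measurable borel" and fin: "Lp_integral p f < \<infinity>" and p: "1 \<le> p"
    and \<kappa>: "probability_density (\<kappa> \<epsilon>)"
    and B: "0 \<le> B" "\<And>h. h \<noteq> 0 \<Longrightarrow> enn2real (increment_integral p f h) \<le> B * norm h powr (s * p)"
  shows "moll_energy \<kappa> s p f \<epsilon> \<le> ennreal B"
proof -
  have [measurable]: "\<kappa> \<epsilon> \<in> borel_measurable lebesgue"
    using \<kappa> by (auto simp: probability_density_def)
  have inner: "(\<integral>\<^sup>+ x. ennreal (\<kappa> \<epsilon> y * \<bar>f (x + y) - f x\<bar> powr p / norm y powr (s * p)) \<partial>lborel)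
      \<le> ennreal B * ennreal (\<kappa> \<epsilon> y)" if "0 \<le> \<kappa> \<epsilon> y" for y
  proof (cases "y = 0")
    case False
    define c where "c = \<kappa> \<epsilon> y / norm y powr (s * p)"
    have c: "0 \<le> c" using that by (simp add: c_def)
    have "(\<integral>\<^sup>+ x. ennreal (\<kappa> \<epsilon> y * \<bar>f (x + y) - f x\<bar> powr p / norm y powr (s * p)) \<partial>lborel)
        = (\<integral>\<^sup>+ x. ennreal c * ennreal (\<bar>f (x + y) - f x\<bar> powr p) \<partial>lborel)"
      using c by (intro nn_integral_cong) (simp add: c_def ennreal_mult[symmetric])
    also have "\<dots> = ennreal c * increment_integral p f y"
      unfolding increment_integral_def by (rule nn_integral_cmult) measurable
    also have "\<dots> = ennreal (c * enn2real (increment_integral p f y))"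
      using c increment_integral_less_top[OF f _ fin, of y] p
      by (simp add: ennreal_mult ennreal_enn2real_if)
    also have "\<dots> \<le> ennreal (c * (B * norm y powr (s * p)))"
      using B(2)[OF False] c by (intro ennreal_leI mult_left_mono)
    also have "\<dots> = ennreal B * ennreal (\<kappa> \<epsilon> y)"
      using False that B(1) by (simp add: c_def ennreal_mult[symmetric] mult.commute)
    finally show ?thesis .
  qed simp
  have "moll_energy \<kappa> s p f \<epsilon>
      = (\<integral>\<^sup>+ y. (\<integral>\<^sup>+ x. ennreal (\<kappa> \<epsilon> y * \<bar>f (x + y) - f x\<bar> powr p / norm y powr (s * p)) \<partial>lborel) \<partial>lebesgue)"
    unfolding moll_energy_def by (simp add: nn_integral_completion)
  also have "\<dots> \<le> (\<integral>\<^sup>+ y. ennreal B * ennreal (\<kappa> \<epsilon> y) \<partial>lebesgue)"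
    using \<kappa> inner unfolding probability_density_def by (intro nn_integral_mono_AE) auto
  also have "\<dots> = ennreal B"
    using nn_integral_probability_density[OF \<kappa>] by (simp add: nn_integral_cmult)
  finally show ?thesis .
qed

lemma moll_energy_le_besov_seminorm:
  fixes \<kappa> :: "real \<Rightarrow> 'a::euclidean_space \<Rightarrow> real"
  assumes f: "f \<in> borel_measurable borel" and fin: "Lp_integral p f < \<infinity>" and p: "1 \<le> p"
    and \<kappa>: "probability_density (\<kappa> \<epsilon>)" and bes: "besov_seminorm s p f < \<infinity>"
  shows "moll_energy \<kappa> s p f \<epsilon> \<le> ennreal (enn2real (besov_seminorm s p f) powr p)"
  using increment_integral_le_besov_seminorm[OF f p fin bes]
  by (intro moll_energy_le_of_increment_bound[where \<kappa>=\<kappa>, OF f fin p \<kappa>]) auto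

lemma Limsup_moll_energy_less_top:
  fixes \<kappa> :: "real \<Rightarrow> 'a::euclidean_space \<Rightarrow> real"
  assumes f: "f \<in> borel_measurable borel" and fin: "Lp_integral p f < \<infinity>" and p: "1 \<le> p"
    and \<kappa>: "\<And>\<epsilon>. 0 < \<epsilon> \<Longrightarrow> probability_density (\<kappa> \<epsilon>)" and bes: "besov_seminorm s p f < \<infinity>"
  shows "Limsup (at_right 0) (moll_energy \<kappa> s p f) < \<infinity>"
proof -
  have "eventually (\<lambda>\<epsilon>. moll_energy \<kappa> s p f \<epsilon> \<le> ennreal (enn2real (besov_seminorm s p f) powr p))
      (at_right 0)"
    using eventually_at_right_less[of "0::real"]
    by eventually_elim (rule moll_energy_le_besov_seminorm[OF f fin p \<kappa> bes])
  then have "Limsup (at_right 0) (moll_energy \<kappa> s p f) \<le> ennreal (enn2real (besov_seminorm s p f) powr p)"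
    by (rule Limsup_bounded)
  then show ?thesis
    using le_less_trans by fastforce
qed

lemma Lp_integral_plus_moll_energy_le_besov_norm:
  fixes \<kappa> :: "real \<Rightarrow> 'a::euclidean_space \<Rightarrow> real"
  assumes f: "f \<in> borel_measurable borel" and fin: "Lp_integral p f < \<infinity>" and p: "1 \<le> p"
    and \<kappa>: "\<And>\<epsilon>. 0 < \<epsilon> \<Longrightarrow> probability_density (\<kappa> \<epsilon>)"
  shows "epow (Lp_norm p f) p + (SUP \<epsilon>\<in>{0<..<1}. moll_energy \<kappa> s p f \<epsilon>) \<le> epow (besov_norm s p f) p"
proof (cases "besov_seminorm s p f < \<infinity>")
  case False
  then show ?thesis
    by (simp add: besov_norm_def epow_def top.not_eq_extremum)
next
  case True
  define L where "L = enn2real (Lp_integral p f) powr (1 / p)"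
  define \<beta> where "\<beta> = enn2real (besov_seminorm s p f)"
  have L: "0 \<le> L" "ennreal (L powr p) = Lp_integral p f"
    using fin p by (simp_all add: L_def powr_powr ennreal_enn2real_if)
  have "(SUP \<epsilon>\<in>{0<..<1}. moll_energy \<kappa> s p f \<epsilon>) \<le> ennreal (\<beta> powr p)"
    unfolding \<beta>_def using moll_energy_le_besov_seminorm[OF f fin p \<kappa> True]
    by (intro SUP_least) auto
  then have "epow (Lp_norm p f) p + (SUP \<epsilon>\<in>{0<..<1}. moll_energy \<kappa> s p f \<epsilon>) \<le> ennreal (L powr p) + ennreal (\<beta> powr p)"
    using epow_Lp_norm[OF fin] p L(2) by (simp add: add_left_mono)
  also have "\<dots> \<le> ennreal ((L + \<beta>) powr p)"
    using add_powr_le_powr_add[OF L(1) _ p, of \<beta>] by (simp add: \<beta>_def flip: ennreal_plus)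
  also have "\<dots> = epow (besov_norm s p f) p"
    using epow_besov_norm[OF p fin True] by (simp add: L_def \<beta>_def)
  finally show ?thesis .
qed

section \<open>A Steinhaus-type lemma\<close>

lemma exists_superlevel_set_positive_measure:
  fixes \<rho> :: "'a::euclidean_space \<Rightarrow> real"
  assumes [measurable]: "\<rho> \<in> borel_measurable lebesgue" and pos: "\<not> (AE u in lebesgue. \<rho> u \<le> 0)"
  obtains \<delta> r where "0 < \<delta>" "0 < r" "{u. \<delta> \<le> \<rho> u} \<inter> cball 0 r \<in> sets lebesgue"
    "emeasure lebesgue ({u. \<delta> \<le> \<rho> u} \<inter> cball 0 r) \<noteq> 0"
proof -
  define S where "S n = {u. 1 / real (Suc n) \<le> \<rho> u} \<inter> cball 0 (real (Suc n))" for n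
  have S: "S n \<in> sets lebesgue" for n
  proof -
    have "{u \<in> space lebesgue. 1 / real (Suc n) \<le> \<rho> u} \<in> sets lebesgue"
      by measurable
    then show ?thesis
      unfolding S_def by (auto intro: sets.Int)
  qed
  have "{u \<in> space lebesgue. \<not> \<rho> u \<le> 0} \<subseteq> (\<Union>n. S n)"
  proof
    fix u
    assume "u \<in> {u \<in> space lebesgue. \<not> \<rho> u \<le> 0}"
    then have u: "0 < \<rho> u" by simp
    obtain n :: nat where n: "norm u \<le> real n" "1 / \<rho> u \<le> real n"
      using real_arch_simple[of "max (norm u) (1 / \<rho> u)"] by auto
    then have "1 \<le> real (Suc n) * \<rho> u"
      using u by (simp add: field_simps distrib_right)
    then show "u \<in> (\<Union>n. S n)"
      using n u by (auto simp: S_def field_simps intro!: exI[of _ n])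
  qed
  note sub = this
  have "\<exists>n. S n \<notin> null_sets lebesgue"
  proof (rule ccontr)
    assume "\<not> (\<exists>n. S n \<notin> null_sets lebesgue)"
    then have "(\<Union>n. S n) \<in> null_sets lebesgue"
      by (intro null_sets_UN) auto
    then have "AE u in lebesgue. \<rho> u \<le> 0"
      using sub by (rule AE_I')
    with pos show False ..
  qed
  then obtain n where "S n \<notin> null_sets lebesgue" ..
  then show thesis
    using S[of n] by (intro that[of "1 / real (Suc n)" "real (Suc n)"]) (auto simp: S_def null_sets_def)
qed

lemma exists_compact_open_measure_less_double:
  fixes S :: "'a::euclidean_space set"
  assumes S: "S \<in> sets lebesgue" "bounded S" "emeasure lebesgue S \<noteq> 0"
  obtains C U where "compact C" "C \<subseteq> S" "open U" "C \<subseteq> U" "U \<in> lmeasurable"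
    "measure lebesgue U < 2 * measure lebesgue C"
proof -
  have Sf: "S \<in> lmeasurable"
    by (rule bounded_set_imp_lmeasurable[OF S(2,1)])
  define \<mu> where "\<mu> = measure lebesgue S"
  have \<mu>: "0 < \<mu>"
    using S(3) Sf by (simp add: \<mu>_def emeasure_eq_measure2 measure_nonneg order_less_le)
  obtain C where C: "closed C" "C \<subseteq> S" "S - C \<in> lmeasurable" "emeasure lebesgue (S - C) < ennreal (\<mu> / 4)"
    using sets_lebesgue_inner_closed[OF S(1), of "\<mu> / 4"] \<mu> by auto
  obtain U where U: "open U" "S \<subseteq> U" "U - S \<in> lmeasurable" "emeasure lebesgue (U - S) < ennreal (\<mu> / 4)"
    using sets_lebesgue_outer_open[OF S(1), of "\<mu> / 4"] \<mu> by auto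
  have Cc: "compact C"
    using C(1,2) S(2) by (meson bounded_subset compact_eq_bounded_closed)
  have Cf: "C \<in> lmeasurable"
    by (rule lmeasurable_compact[OF Cc])
  have "measure lebesgue (S - C) < \<mu> / 4"
    using C(3,4) \<mu> by (simp add: emeasure_eq_measure2 ennreal_less_iff)
  moreover have "measure lebesgue (S - C) = \<mu> - measure lebesgue C"
    unfolding \<mu>_def using Sf Cf C(2) by (intro measure_Diff) (auto simp: fmeasurable_def)
  ultimately have mC: "3 * \<mu> / 4 < measure lebesgue C"
    by simp
  have USeq: "U = S \<union> (U - S)"
    using U(2) by auto
  have Uf: "U \<in> lmeasurable"
    using Sf U(3) by (subst USeq) (rule fmeasurable.Un)
  have "measure lebesgue (U - S) < \<mu> / 4"
    using U(3,4) \<mu> by (simp add: emeasure_eq_measure2 ennreal_less_iff)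
  moreover have "measure lebesgue U \<le> \<mu> + measure lebesgue (U - S)"
    unfolding \<mu>_def using Sf U(3) by (subst USeq) (intro measure_Un_le; auto simp: fmeasurable_def)
  ultimately have "measure lebesgue U < 2 * measure lebesgue C"
    using mC \<mu> by simp
  then show thesis
    using Cc C(2) U(1,2) Uf by (intro that[of C U]) auto
qed

text \<open>Translating \<open>C\<close> by less than its distance to the complement of \<open>U\<close> keeps it inside \<open>U\<close>,
  so inclusion--exclusion bounds the overlap from below.\<close>
lemma emeasure_translate_overlap_ge:
  fixes C U :: "'a::euclidean_space set"
  assumes C: "compact C" and U: "open U" "C \<subseteq> U" "U \<in> lmeasurable"
  obtains d where "0 < d" "\<And>w. norm w < d \<Longrightarrow>
    ennreal (2 * measure lebesgue C - measure lebesgue U) \<le> emeasure lebesgue {v \<in> C. v + w \<in> C}"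
proof -
  have disj: "C \<inter> - U = {}"
    using U by auto
  obtain d where d: "d > 0" "\<And>x y. x \<in> C \<Longrightarrow> y \<in> - U \<Longrightarrow> d \<le> dist x y"
    using separate_compact_closed[OF C _ disj] U(1) by (auto simp: closed_Compl)
  have Cf: "C \<in> lmeasurable"
    by (rule lmeasurable_compact[OF C])
  show thesis
  proof (rule that[OF d(1)])
    fix w :: 'a
    assume w: "norm w < d"
    define C' where "C' = (\<lambda>x. x - w) ` C"
    have eq: "{v \<in> C. v + w \<in> C} = C \<inter> C'"
      by (auto simp: C'_def image_iff) (metis add_diff_cancel)
    have "C' \<subseteq> U"
    proof
      fix v
      assume "v \<in> C'"
      then have "v + w \<in> C" by (auto simp: C'_def)
      with d(2)[of "v + w" v] w show "v \<in> U"
        by (force simp: dist_norm)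
    qed
    moreover have C'f: "C' \<in> lmeasurable"
      unfolding C'_def by (rule measurable_translation_subtract[OF Cf])
    ultimately have "measure lebesgue (C \<union> C') \<le> measure lebesgue U"
      using U Cf by (intro measure_mono_fmeasurable) (auto simp: fmeasurable_def)
    moreover have "measure lebesgue C' = measure lebesgue C"
      unfolding C'_def by (rule measure_translation_subtract)
    ultimately have "2 * measure lebesgue C - measure lebesgue U \<le> measure lebesgue (C \<inter> C')"
      using measure_Un3[OF Cf C'f] by simp
    moreover have "emeasure lebesgue (C \<inter> C') = ennreal (measure lebesgue (C \<inter> C'))"
      using Cf C'f by (intro emeasure_eq_measure2) auto
    ultimately show "ennreal (2 * measure lebesgue C - measure lebesgue U) \<le> emeasure lebesgue {v \<in> C. v + w \<in> C}"
      unfolding eq by (simp add: ennreal_leI)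
  qed
qed

locale kernel_core =
  fixes \<rho> :: "'a::euclidean_space \<Rightarrow> real" and K :: "'a set" and b \<delta> d m :: real
  assumes compact_K: "compact K" and K_subset_cball: "K \<subseteq> cball 0 b" and b_pos: "0 < b"
    and \<delta>_pos: "0 < \<delta>" and \<delta>_le_\<rho>: "\<And>u. u \<in> K \<Longrightarrow> \<delta> \<le> \<rho> u"
    and d_pos: "0 < d" and m_pos: "0 < m"
    and overlap_ge: "\<And>w. norm w < d \<Longrightarrow> ennreal m \<le> emeasure lebesgue {v \<in> K. v + w \<in> K}"

lemma probability_density_kernel_core:
  fixes \<rho> :: "'a::euclidean_space \<Rightarrow> real"
  assumes \<rho>: "probability_density \<rho>"
  shows "\<exists>K b \<delta> d m. kernel_core \<rho> K b \<delta> d m"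
proof -
  have "\<not> (AE u in lebesgue. \<rho> u \<le> 0)"
  proof
    assume "AE u in lebesgue. \<rho> u \<le> 0"
    moreover have "AE u in lebesgue. 0 \<le> \<rho> u"
      using \<rho> by (simp add: probability_density_def)
    ultimately have "AE u in lebesgue. \<rho> u = 0"
      by eventually_elim auto
    then have "integral\<^sup>L lebesgue \<rho> = 0"
      by (rule integral_eq_zero_AE)
    with \<rho> show False
      by (simp add: probability_density_def)
  qed
  moreover have "\<rho> \<in> borel_measurable lebesgue"
    using \<rho> by (auto simp: probability_density_def)
  ultimately obtain \<delta> r where \<delta>r: "0 < \<delta>" "0 < r"
    "{u. \<delta> \<le> \<rho> u} \<inter> cball 0 r \<in> sets lebesgue" "emeasure lebesgue ({u. \<delta> \<le> \<rho> u} \<inter> cball 0 r) \<noteq> 0"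
    using exists_superlevel_set_positive_measure by blast
  moreover have "bounded ({u. \<delta> \<le> \<rho> u} \<inter> cball 0 r)"
    by (rule bounded_subset[OF bounded_cball]) auto
  ultimately obtain C U where CU: "compact C" "C \<subseteq> {u. \<delta> \<le> \<rho> u} \<inter> cball 0 r" "open U" "C \<subseteq> U"
    "U \<in> lmeasurable" "measure lebesgue U < 2 * measure lebesgue C"
    using exists_compact_open_measure_less_double by blast
  obtain d where d: "0 < d" "\<And>w. norm w < d \<Longrightarrow>
      ennreal (2 * measure lebesgue C - measure lebesgue U) \<le> emeasure lebesgue {v \<in> C. v + w \<in> C}"
    using emeasure_translate_overlap_ge[OF CU(1,3,4,5)] by blast
  have "kernel_core \<rho> C r \<delta> d (2 * measure lebesgue C - measure lebesgue U)"
    by unfold_locales (use CU \<delta>r d in auto)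
  then show ?thesis
    by blast
qed

section \<open>Lower bound through the core of the kernel\<close>

context kernel_core
begin

lemma rescale_div_norm_powr_ge:
  assumes \<epsilon>: "0 < \<epsilon>" and q: "0 < q" and y: "y \<in> (*\<^sub>R) \<epsilon> ` K" "y \<noteq> 0"
  shows "\<delta> / (\<epsilon> ^ DIM('a) * (\<epsilon> * b) powr q) \<le> rescale \<rho> \<epsilon> y / norm y powr q"
proof -
  obtain v where v: "v \<in> K" "y = \<epsilon> *\<^sub>R v"
    using y(1) by auto
  have "rescale \<rho> \<epsilon> y = \<rho> v / \<epsilon> ^ DIM('a)"
    unfolding rescale_def using v(2) \<epsilon> by (simp add: field_simps)
  moreover have "norm y powr q \<le> (\<epsilon> * b) powr q"
    using v K_subset_cball \<epsilon> q by (intro powr_mono2) (auto simp: mult_left_mono)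
  then have "1 / (\<epsilon> * b) powr q \<le> 1 / norm y powr q"
    using y(2) \<epsilon> b_pos by (intro divide_left_mono) auto
  moreover have "\<delta> / \<epsilon> ^ DIM('a) \<le> \<rho> v / \<epsilon> ^ DIM('a)"
    using \<delta>_le_\<rho>[OF v(1)] \<epsilon> by (simp add: divide_right_mono)
  ultimately have "(\<delta> / \<epsilon> ^ DIM('a)) * (1 / (\<epsilon> * b) powr q) \<le> rescale \<rho> \<epsilon> y * (1 / norm y powr q)"
    using \<delta>_pos \<epsilon> by (intro mult_mono) (auto intro: order_trans[of 0 "\<delta> / \<epsilon> ^ DIM('a)"])
  then show ?thesis
    by simp
qed

lemma moll_energy_ge_scaled_core_integral:
  assumes [measurable]: "f \<in> borel_measurable borel" and q: "0 < s * p" and \<epsilon>: "0 < \<epsilon>"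
  shows "ennreal (\<delta> / (\<epsilon> ^ DIM('a) * (\<epsilon> * b) powr (s * p)))
      * (\<integral>\<^sup>+ y. indicator ((*\<^sub>R) \<epsilon> ` K) y * increment_integral p f y \<partial>lborel)
    \<le> moll_energy (rescale \<rho>) s p f \<epsilon>"
proof -
  define c where "c = \<delta> / (\<epsilon> ^ DIM('a) * (\<epsilon> * b) powr (s * p))"
  have c: "0 < c"
    unfolding c_def using \<delta>_pos b_pos \<epsilon> by simp
  have pointwise: "ennreal c * (indicator ((*\<^sub>R) \<epsilon> ` K) y * increment_integral p f y)
      \<le> (\<integral>\<^sup>+ x. ennreal (rescale \<rho> \<epsilon> y * \<bar>f (x + y) - f x\<bar> powr p / norm y powr (s * p)) \<partial>lborel)" for y
  proof (cases "y \<in> (*\<^sub>R) \<epsilon> ` K \<and> y \<noteq> 0")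
    case True
    then have "c \<le> rescale \<rho> \<epsilon> y / norm y powr (s * p)"
      unfolding c_def using rescale_div_norm_powr_ge[OF \<epsilon> q] by blast
    then have "ennreal c * ennreal (\<bar>f (x + y) - f x\<bar> powr p)
        \<le> ennreal (rescale \<rho> \<epsilon> y * \<bar>f (x + y) - f x\<bar> powr p / norm y powr (s * p))" for x
    proof -
      have "c * \<bar>f (x + y) - f x\<bar> powr p
          \<le> rescale \<rho> \<epsilon> y / norm y powr (s * p) * \<bar>f (x + y) - f x\<bar> powr p"
        using \<open>c \<le> _\<close> by (intro mult_right_mono) auto
      then show ?thesis
        using c by (simp add: ennreal_mult[symmetric] ennreal_leI)
    qed
    then have "(\<integral>\<^sup>+ x. ennreal c * ennreal (\<bar>f (x + y) - f x\<bar> powr p) \<partial>lborel)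
        \<le> (\<integral>\<^sup>+ x. ennreal (rescale \<rho> \<epsilon> y * \<bar>f (x + y) - f x\<bar> powr p / norm y powr (s * p)) \<partial>lborel)"
      by (rule nn_integral_mono)
    then show ?thesis
      using True unfolding increment_integral_def by (simp add: nn_integral_cmult)
  qed (auto simp: indicator_def)
  have "ennreal c * (\<integral>\<^sup>+ y. indicator ((*\<^sub>R) \<epsilon> ` K) y * increment_integral p f y \<partial>lborel)
      = (\<integral>\<^sup>+ y. ennreal c * (indicator ((*\<^sub>R) \<epsilon> ` K) y * increment_integral p f y) \<partial>lborel)"
  proof (intro nn_integral_cmult[symmetric])
    have [measurable]: "(*\<^sub>R) \<epsilon> ` K \<in> sets borel"
      using compact_scaling[OF compact_K] by (simp add: compact_imp_closed)
    show "(\<lambda>y. indicator ((*\<^sub>R) \<epsilon> ` K) y * increment_integral p f y) \<in> borel_measurable lborel"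
      by measurable
  qed
  also have "\<dots> \<le> moll_energy (rescale \<rho>) s p f \<epsilon>"
    unfolding moll_energy_def nn_integral_completion using pointwise by (rule nn_integral_mono)
  finally show ?thesis
    unfolding c_def .
qed

lemma increment_integral_le_moll_energy:
  assumes [measurable]: "f \<in> borel_measurable borel" and p: "1 \<le> p" and s: "0 < s"
    and \<epsilon>: "0 < \<epsilon>" and h: "norm h < \<epsilon> * d"
  shows "ennreal m * increment_integral p f h
    \<le> ennreal (2 * 2 powr p * (\<epsilon> * b) powr (s * p) / \<delta>) * moll_energy (rescale \<rho>) s p f \<epsilon>"
proof -
  define N where "N = \<epsilon> ^ DIM('a)"
  define A where "A = (*\<^sub>R) \<epsilon> ` K"
  define J where "J = (\<integral>\<^sup>+ y. indicator A y * increment_integral p f y \<partial>lborel)"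
  define c where "c = \<delta> / (N * (\<epsilon> * b) powr (s * p))"
  define E where "E = moll_energy (rescale \<rho>) s p f \<epsilon>"
  have N: "0 < N" and c: "0 < c"
    using \<epsilon> \<delta>_pos b_pos by (simp_all add: N_def c_def)
  have [measurable]: "A \<in> sets borel"
    unfolding A_def using compact_scaling[OF compact_K] by (simp add: compact_imp_closed)
  have "norm ((1 / \<epsilon>) *\<^sub>R h) < d"
    using h \<epsilon> by (simp add: field_simps)
  then have overlap: "ennreal N * ennreal m \<le> emeasure lebesgue {y \<in> A. y + h \<in> A}"
    unfolding A_def N_def emeasure_scaled_overlap[OF \<epsilon>] by (intro mult_left_mono overlap_ge) auto
  have "ennreal N * (ennreal m * increment_integral p f h)
      = (ennreal N * ennreal m) * increment_integral p f h"
    by (simp add: mult.assoc)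
  also have "\<dots> \<le> increment_integral p f h * emeasure lebesgue {y \<in> A. y + h \<in> A}"
    using overlap by (simp add: mult.commute mult_left_mono)
  also have "\<dots> \<le> ennreal (2 * 2 powr p) * J"
    unfolding J_def using p by (intro increment_integral_overlap_average) auto
  also have "J = ennreal (1 / c) * (ennreal c * J)"
    using c by (simp add: ennreal_mult'[symmetric] mult.assoc[symmetric])
  also have "ennreal c * J \<le> E"
    unfolding c_def J_def E_def A_def N_def
    using s p \<epsilon> by (intro moll_energy_ge_scaled_core_integral) auto
  also have "ennreal (2 * 2 powr p) * (ennreal (1 / c) * E) = ennreal (2 * 2 powr p * (1 / c)) * E"
    using c by (subst ennreal_mult[of "2 * 2 powr p" "1 / c"]) (auto simp: mult.assoc)
  also have "2 * 2 powr p * (1 / c) = N * (2 * 2 powr p * (\<epsilon> * b) powr (s * p) / \<delta>)"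
    using \<delta>_pos by (simp add: c_def field_simps)
  also have "ennreal (N * (2 * 2 powr p * (\<epsilon> * b) powr (s * p) / \<delta>)) * E
      = ennreal N * (ennreal (2 * 2 powr p * (\<epsilon> * b) powr (s * p) / \<delta>) * E)"
    using N \<delta>_pos
    by (subst ennreal_mult[of N "2 * 2 powr p * (\<epsilon> * b) powr (s * p) / \<delta>"]) (auto simp: mult.assoc)
  finally show ?thesis
    using N unfolding E_def by (simp add: ennreal_mult_le_mult_iff mult_left_mono)
qed

lemma increment_integral_le_moll_energy_small_shift:
  assumes [measurable]: "f \<in> borel_measurable borel" and fin: "Lp_integral p f < \<infinity>"
    and p: "1 \<le> p" and s: "0 < s" and M: "0 \<le> M" and h: "norm h < \<epsilon>\<^sub>0 * d / 2"
    and energy: "\<And>\<epsilon>. 0 < \<epsilon> \<Longrightarrow> \<epsilon> < \<epsilon>\<^sub>0 \<Longrightarrow> moll_energy (rescale \<rho>) s p f \<epsilon> \<le> ennreal M"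
  shows "enn2real (increment_integral p f h)
    \<le> 2 * 2 powr p * (2 * b / d) powr (s * p) / (\<delta> * m) * M * norm h powr (s * p)"
proof (cases "h = 0")
  case False
  define G where "G = enn2real (increment_integral p f h)"
  define \<epsilon> where "\<epsilon> = 2 * norm h / d"
  have \<epsilon>: "0 < \<epsilon>" "\<epsilon> < \<epsilon>\<^sub>0" "norm h < \<epsilon> * d"
    using False h d_pos by (auto simp: \<epsilon>_def field_simps)
  define B where "B = 2 * 2 powr p * (\<epsilon> * b) powr (s * p) / \<delta>"
  have B: "0 \<le> B"
    using \<delta>_pos by (simp add: B_def)
  have "ennreal (m * G) = ennreal m * increment_integral p f h"
    using increment_integral_less_top[of f p h] fin p m_pos
    by (simp add: G_def ennreal_mult ennreal_enn2real_if)
  also have "\<dots> \<le> ennreal B * moll_energy (rescale \<rho>) s p f \<epsilon>"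
    unfolding B_def using increment_integral_le_moll_energy[OF _ p s \<epsilon>(1,3)] by simp
  also have "\<dots> \<le> ennreal B * ennreal M"
    using energy[OF \<epsilon>(1,2)] by (rule mult_left_mono) simp
  finally have "m * G \<le> B * M"
    using B M by (simp add: ennreal_mult[symmetric])
  moreover have "(\<epsilon> * b) powr (s * p) = (2 * b / d) powr (s * p) * norm h powr (s * p)"
    using d_pos b_pos by (simp add: \<epsilon>_def powr_mult[symmetric] field_simps)
  ultimately show ?thesis
    using m_pos \<delta>_pos by (simp add: G_def B_def field_simps)
qed simp

lemma increment_integral_le_moll_energy_bound:
  assumes [measurable]: "f \<in> borel_measurable borel" and fin: "Lp_integral p f < \<infinity>"
    and p: "1 \<le> p" and s: "0 < s" and \<epsilon>\<^sub>0: "0 < \<epsilon>\<^sub>0" and M: "0 \<le> M"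
    and energy: "\<And>\<epsilon>. 0 < \<epsilon> \<Longrightarrow> \<epsilon> < \<epsilon>\<^sub>0 \<Longrightarrow> moll_energy (rescale \<rho>) s p f \<epsilon> \<le> ennreal M"
  shows "enn2real (increment_integral p f h)
    \<le> (2 * 2 powr p * (2 * b / d) powr (s * p) / (\<delta> * m) * M
        + 2 * 2 powr p * (2 / d) powr (s * p) / \<epsilon>\<^sub>0 powr (s * p) * enn2real (Lp_integral p f))
      * norm h powr (s * p)"
proof -
  define q where "q = s * p"
  define G where "G = enn2real (increment_integral p f h)"
  define I where "I = enn2real (Lp_integral p f)"
  define C\<^sub>1 where "C\<^sub>1 = 2 * 2 powr p * (2 * b / d) powr q / (\<delta> * m)"
  define C\<^sub>2 where "C\<^sub>2 = 2 * 2 powr p * (2 / d) powr q / \<epsilon>\<^sub>0 powr q"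
  have q: "0 < q" and I: "0 \<le> I" and C: "0 \<le> C\<^sub>1" "0 \<le> C\<^sub>2"
    using s p \<delta>_pos m_pos by (simp_all add: q_def I_def C\<^sub>1_def C\<^sub>2_def)
  have "G \<le> (C\<^sub>1 * M + C\<^sub>2 * I) * norm h powr q"
  proof (cases "norm h < \<epsilon>\<^sub>0 * d / 2")
    case True
    then have "G \<le> C\<^sub>1 * M * norm h powr q"
      unfolding G_def C\<^sub>1_def q_def using energy
      by (intro increment_integral_le_moll_energy_small_shift[OF _ fin p s M]) auto
    then show ?thesis
      using C I by (simp add: distrib_right add_increasing2)
  next
    case False
    have "(2 / d) powr q * (\<epsilon>\<^sub>0 * d / 2) powr q = \<epsilon>\<^sub>0 powr q"
      using \<epsilon>\<^sub>0 d_pos by (simp add: powr_mult[symmetric])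
    then have "2 * 2 powr p = C\<^sub>2 * (\<epsilon>\<^sub>0 * d / 2) powr q"
      using \<epsilon>\<^sub>0 by (simp add: C\<^sub>2_def mult.assoc)
    also have "\<dots> \<le> C\<^sub>2 * norm h powr q"
      using False \<epsilon>\<^sub>0 d_pos q C by (intro mult_left_mono powr_mono2) auto
    finally have "2 * 2 powr p * I \<le> C\<^sub>2 * I * norm h powr q"
      using I by (metis mult.commute mult.left_commute mult_right_mono)
    moreover have "G \<le> 2 * 2 powr p * I"
      using enn2real_increment_integral_le[of f p h] fin p by (simp add: G_def I_def)
    ultimately show ?thesis
      using C M by (simp add: distrib_right add_increasing)
  qed
  then show ?thesis
    by (simp add: G_def I_def C\<^sub>1_def C\<^sub>2_def q_def)
qed

lemma besov_seminorm_le_moll_energy_bound: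
  assumes p: "1 \<le> p" and s: "0 < s"
  obtains C\<^sub>1 C\<^sub>2 where "0 \<le> C\<^sub>1" "0 \<le> C\<^sub>2"
    "\<And>f \<epsilon>\<^sub>0 M. f \<in> borel_measurable borel \<Longrightarrow> Lp_integral p f < \<infinity> \<Longrightarrow> 0 < \<epsilon>\<^sub>0 \<Longrightarrow> 0 \<le> M \<Longrightarrow>
      (\<And>\<epsilon>. 0 < \<epsilon> \<Longrightarrow> \<epsilon> < \<epsilon>\<^sub>0 \<Longrightarrow> moll_energy (rescale \<rho>) s p f \<epsilon> \<le> ennreal M) \<Longrightarrow>
      besov_seminorm s p f
        \<le> ennreal ((C\<^sub>1 * M + C\<^sub>2 / \<epsilon>\<^sub>0 powr (s * p) * enn2real (Lp_integral p f)) powr (1 / p))"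
proof -
  define C\<^sub>1 where "C\<^sub>1 = 2 * 2 powr p * (2 * b / d) powr (s * p) / (\<delta> * m)"
  define C\<^sub>2 where "C\<^sub>2 = 2 * 2 powr p * (2 / d) powr (s * p)"
  have C: "0 \<le> C\<^sub>1" "0 \<le> C\<^sub>2"
    using \<delta>_pos m_pos by (simp_all add: C\<^sub>1_def C\<^sub>2_def)
  show thesis
  proof (rule that[OF C])
    fix f :: "'a \<Rightarrow> real" and \<epsilon>\<^sub>0 M :: real
    assume f: "f \<in> borel_measurable borel" and fin: "Lp_integral p f < \<infinity>" and "0 < \<epsilon>\<^sub>0" "0 \<le> M"
      and "\<And>\<epsilon>. 0 < \<epsilon> \<Longrightarrow> \<epsilon> < \<epsilon>\<^sub>0 \<Longrightarrow> moll_energy (rescale \<rho>) s p f \<epsilon> \<le> ennreal M"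
    then show "besov_seminorm s p f
        \<le> ennreal ((C\<^sub>1 * M + C\<^sub>2 / \<epsilon>\<^sub>0 powr (s * p) * enn2real (Lp_integral p f)) powr (1 / p))"
      using increment_integral_le_moll_energy_bound[OF f fin p s] C \<delta>_pos m_pos
      by (intro besov_seminorm_le_of_increment_bound[OF f p fin]) (simp_all add: C\<^sub>1_def C\<^sub>2_def)
  qed
qed

lemma besov_seminorm_less_top_if_Limsup_moll_energy:
  assumes f: "f \<in> borel_measurable borel" and fin: "Lp_integral p f < \<infinity>" and p: "1 \<le> p" and s: "0 < s"
    and lim: "Limsup (at_right 0) (moll_energy (rescale \<rho>) s p f) < \<infinity>"
  shows "besov_seminorm s p f < \<infinity>"
proof -
  obtain C\<^sub>1 C\<^sub>2 where C: "0 \<le> C\<^sub>1" "0 \<le> C\<^sub>2" and bound: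
    "\<And>\<epsilon>\<^sub>0 M. 0 < \<epsilon>\<^sub>0 \<Longrightarrow> 0 \<le> M \<Longrightarrow>
      (\<And>\<epsilon>. 0 < \<epsilon> \<Longrightarrow> \<epsilon> < \<epsilon>\<^sub>0 \<Longrightarrow> moll_energy (rescale \<rho>) s p f \<epsilon> \<le> ennreal M) \<Longrightarrow>
      besov_seminorm s p f
        \<le> ennreal ((C\<^sub>1 * M + C\<^sub>2 / \<epsilon>\<^sub>0 powr (s * p) * enn2real (Lp_integral p f)) powr (1 / p))"
    using besov_seminorm_le_moll_energy_bound[OF p s] f fin by metis
  define M where "M = enn2real (Limsup (at_right 0) (moll_energy (rescale \<rho>) s p f)) + 1"
  have "Limsup (at_right 0) (moll_energy (rescale \<rho>) s p f) < ennreal M"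
    using lim by (simp add: M_def ennreal_enn2real_if ennreal_less_iff)
  then have "eventually (\<lambda>\<epsilon>. moll_energy (rescale \<rho>) s p f \<epsilon> < ennreal M) (at_right 0)"
    by (rule Limsup_lessD)
  then obtain \<epsilon>\<^sub>0 where "0 < \<epsilon>\<^sub>0" "\<And>\<epsilon>. 0 < \<epsilon> \<Longrightarrow> \<epsilon> < \<epsilon>\<^sub>0 \<Longrightarrow> moll_energy (rescale \<rho>) s p f \<epsilon> < ennreal M"
    unfolding eventually_at_right_field by auto
  then have "besov_seminorm s p f
      \<le> ennreal ((C\<^sub>1 * M + C\<^sub>2 / \<epsilon>\<^sub>0 powr (s * p) * enn2real (Lp_integral p f)) powr (1 / p))"
    by (intro bound) (auto simp: M_def less_imp_le)
  then show ?thesis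
    using le_less_trans by fastforce
qed

lemma besov_norm_le_Lp_integral_plus_moll_energy:
  assumes p: "1 \<le> p" and s: "0 < s"
  obtains c where "0 < c" "c \<le> 1"
    "\<And>f. f \<in> borel_measurable borel \<Longrightarrow> Lp_integral p f < \<infinity> \<Longrightarrow>
      ennreal c * epow (besov_norm s p f) p
        \<le> epow (Lp_norm p f) p + (SUP \<epsilon>\<in>{0<..<1}. moll_energy (rescale \<rho>) s p f \<epsilon>)"
proof -
  obtain C\<^sub>1 C\<^sub>2 where C: "0 \<le> C\<^sub>1" "0 \<le> C\<^sub>2" and bound:
    "\<And>f M. f \<in> borel_measurable borel \<Longrightarrow> Lp_integral p f < \<infinity> \<Longrightarrow> 0 \<le> M \<Longrightarrow>
      (\<And>\<epsilon>. 0 < \<epsilon> \<Longrightarrow> \<epsilon> < 1 \<Longrightarrow> moll_energy (rescale \<rho>) s p f \<epsilon> \<le> ennreal M) \<Longrightarrow>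
      besov_seminorm s p f \<le> ennreal ((C\<^sub>1 * M + C\<^sub>2 * enn2real (Lp_integral p f)) powr (1 / p))"
    using besov_seminorm_le_moll_energy_bound[OF p s] by (metis zero_less_one powr_one_eq_one div_by_1)
  have "1 \<le> (2::real) powr p"
    using p by (intro ge_one_powr_ge_zero) auto
  then have "1 \<le> 2 powr p * (1 + C\<^sub>1 + C\<^sub>2)"
    using C mult_mono[of 1 "2 powr p" 1 "1 + C\<^sub>1 + C\<^sub>2"] by simp
  then have c: "0 < 1 / (2 powr p * (1 + C\<^sub>1 + C\<^sub>2))" "1 / (2 powr p * (1 + C\<^sub>1 + C\<^sub>2)) \<le> 1"
    by simp_all
  show thesis
  proof (rule that[OF c])
    fix f :: "'a \<Rightarrow> real"
    assume f: "f \<in> borel_measurable borel" and fin: "Lp_integral p f < \<infinity>"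
    define S where "S = (SUP \<epsilon>\<in>{0<..<1}. moll_energy (rescale \<rho>) s p f \<epsilon>)"
    show "ennreal (1 / (2 powr p * (1 + C\<^sub>1 + C\<^sub>2))) * epow (besov_norm s p f) p \<le> epow (Lp_norm p f) p + S"
    proof (cases "S = \<infinity>")
      case False
      define S' where "S' = enn2real S"
      have S: "S = ennreal S'"
        using False by (simp add: S'_def ennreal_enn2real_if top.not_eq_extremum)
      have "moll_energy (rescale \<rho>) s p f \<epsilon> \<le> ennreal S'" if "0 < \<epsilon>" "\<epsilon> < 1" for \<epsilon>
        using that unfolding S[symmetric] S_def by (auto intro: SUP_upper)
      then have "besov_seminorm s p f \<le> ennreal ((C\<^sub>1 * S' + C\<^sub>2 * enn2real (Lp_integral p f)) powr (1 / p))"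
        using f fin by (intro bound) (auto simp: S'_def)
      then show ?thesis
        unfolding S using epow_besov_norm_le_of_seminorm_bound[OF p fin C] by (simp add: S'_def)
    qed simp
  qed
qed

end

theorem proposition1p2:
  fixes \<rho> :: "'a::euclidean_space \<Rightarrow> real" and s p :: real
  assumes "0 < s" "s < 1" "1 \<le> p"
    and "integrable lebesgue \<rho>"
    and "mollifier_family (rescale \<rho>)"
  shows "(\<forall>f. in_Lp p f \<longrightarrow>
            (in_Besov s p f \<longleftrightarrow> Limsup (at_right 0) (moll_energy (rescale \<rho>) s p f) < top))
       \<and> (\<exists>c C :: real. 0 < c \<and> c \<le> C \<and>
            (\<forall>f. in_Lp p f \<longrightarrow>
               ennreal c * epow (besov_norm s p f) p
                 \<le> epow (Lp_norm p f) p + (SUP \<epsilon>\<in>{0<..<1}. moll_energy (rescale \<rho>) s p f \<epsilon>)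
             \<and> epow (Lp_norm p f) p + (SUP \<epsilon>\<in>{0<..<1}. moll_energy (rescale \<rho>) s p f \<epsilon>)
                 \<le> ennreal C * epow (besov_norm s p f) p))"
proof -
  have s: "0 < s" and p: "1 \<le> p"
    using assms by auto
  have densities: "\<And>\<epsilon>. 0 < \<epsilon> \<Longrightarrow> probability_density (rescale \<rho> \<epsilon>)"
    using mollifier_family_probability_density[OF assms(5)] .
  moreover have "rescale \<rho> 1 = \<rho>"
    by (simp add: rescale_def fun_eq_iff)
  ultimately have "probability_density \<rho>"
    by (metis zero_less_one)
  then obtain K b \<delta> d m where "kernel_core \<rho> K b \<delta> d m"
    using probability_density_kernel_core by blast
  then interpret kernel_core \<rho> K b \<delta> d m .
  obtain c where c: "0 < c" "c \<le> 1" and lower: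
    "\<And>f. f \<in> borel_measurable borel \<Longrightarrow> Lp_integral p f < \<infinity> \<Longrightarrow>
      ennreal c * epow (besov_norm s p f) p
        \<le> epow (Lp_norm p f) p + (SUP \<epsilon>\<in>{0<..<1}. moll_energy (rescale \<rho>) s p f \<epsilon>)"
    using besov_norm_le_Lp_integral_plus_moll_energy[OF p s] by blast
  have "(in_Besov s p f \<longleftrightarrow> Limsup (at_right 0) (moll_energy (rescale \<rho>) s p f) < top)
      \<and> ennreal c * epow (besov_norm s p f) p
          \<le> epow (Lp_norm p f) p + (SUP \<epsilon>\<in>{0<..<1}. moll_energy (rescale \<rho>) s p f \<epsilon>)
      \<and> epow (Lp_norm p f) p + (SUP \<epsilon>\<in>{0<..<1}. moll_energy (rescale \<rho>) s p f \<epsilon>)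
          \<le> ennreal 1 * epow (besov_norm s p f) p" if f: "in_Lp p f" for f
  proof -
    obtain g where g: "g \<in> borel_measurable borel" "Lp_integral p g < \<infinity>" "Lp_norm p f = Lp_norm p g"
      "besov_seminorm s p f = besov_seminorm s p g" "moll_energy (rescale \<rho>) s p f = moll_energy (rescale \<rho>) s p g"
      using in_Lp_borel_representative[OF f] by blast
    have "in_Besov s p f \<longleftrightarrow> besov_seminorm s p g < \<infinity>"
      using f g(4) by (simp add: in_Besov_def)
    also have "\<dots> \<longleftrightarrow> Limsup (at_right 0) (moll_energy (rescale \<rho>) s p g) < \<infinity>"
      using Limsup_moll_energy_less_top[where \<kappa>="rescale \<rho>", OF g(1,2) p densities]
        besov_seminorm_less_top_if_Limsup_moll_energy[OF g(1,2) p s] by blast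
    moreover have "besov_norm s p f = besov_norm s p g"
      using g(3,4) by (simp add: besov_norm_def)
    ultimately show ?thesis
      using lower[OF g(1,2)] Lp_integral_plus_moll_energy_le_besov_norm[where \<kappa>="rescale \<rho>", OF g(1,2) p densities] g(3,5)
      by simp
  qed
  with c show ?thesis
    by (intro conjI allI impI exI[of _ c] exI[of _ "1::real"]) auto
qed

end
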